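(* There exists a hypergraphic preference system $I=(H=(V,E),\succ)$ with $H$ an interval hypergraph such that the fractional stable matching polytope $Q(I)$ is not integral; consequently $P(I)\neq Q(I)$.
   Context: A hypergraphic preference system $(H=(V,E),\succ)$ consists of a hypergraph $H$ and, for each $i\in V$, a strict order $\succ_i$ on $\delta(i)=\{e\in E:i\in e\}$. Each singleton $\{i\}$ is assumed to be in $E$ and to be the least preferred element of $\delta(i)$. A stable matching is $x\in\{0,1\}^E$ such that for every $e\in E$ there is $i\in e$ with $\sum_{e'\in\delta(i),\,e'\succeq_i e}x_{e'}=1$, where $\succeq_i$ means $\succ_i$ or equal. A hypergraph is an interval hypergraph if $V=[n]$ and every hyperedge has the form $\{i,i+1,\dots,j\}$ with $i\le j$. $P(I)$ is the convex hull of all stable matchings. $Q(I)=\{x\in\mathbb{R}^E: x(\delta(i))\le1\ \forall i\in V;\ x(e^{\succeq})\ge1\ \forall e\in E;\ 0\le x_e\le1\ \forall e\in E\}$. Here $x(F)=\sum_{e\in F}x_e$ and $e^{\succeq}=\{e'\in E:\exists i\in e,\ e'\succ_i e\}\cup\{e\}$. A polytope is integral if all its extreme points are integer vectors. *)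

theory Defs
  imports "HOL-Analysis.Analysis" "HOL-Analysis.Finite_Function_Topology"
begin

definition hypergraph :: "'v set \<Rightarrow> 'v set set \<Rightarrow> bool" where
  "hypergraph V E \<longleftrightarrow> finite V \<and> (\<forall>e\<in>E. e \<noteq> {} \<and> e \<subseteq> V)"

definition incident :: "'v set set \<Rightarrow> 'v \<Rightarrow> 'v set set" where
  "incident E i = {e \<in> E. i \<in> e}"

text \<open>
  The order of vertex \<open>i\<close> is the relation \<open>R i\<close>, where \<open>(e, f) \<in> R i\<close> means that
  \<open>i\<close> strictly prefers \<open>e\<close> to \<open>f\<close>. The inclusion in the product is required because
  \<^const>\<open>strict_linear_order_on\<close> does not restrict the field of the relation.
\<close>

definition hypergraphic_preference_system ::
    "'v set \<Rightarrow> 'v set set \<Rightarrow> ('v \<Rightarrow> 'v set rel) \<Rightarrow> bool" where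
  "hypergraphic_preference_system V E R \<longleftrightarrow>
     hypergraph V E \<and>
     (\<forall>i\<in>V. R i \<subseteq> incident E i \<times> incident E i \<and>
            strict_linear_order_on (incident E i) (R i)) \<and>
     (\<forall>i\<in>V. {i} \<in> E \<and> (\<forall>e\<in>incident E i. e \<noteq> {i} \<longrightarrow> (e, {i}) \<in> R i))"

definition interval_hypergraph :: "nat \<Rightarrow> nat set set \<Rightarrow> bool" where
  "interval_hypergraph n E \<longleftrightarrow>
     hypergraph {1..n} E \<and> (\<forall>e\<in>E. \<exists>i j. i \<le> j \<and> e = {i..j})"

text \<open>
  For a finite set \<open>E\<close>, the space of real vectors indexed by \<open>E\<close> is represented by the
  finitely supported functions whose support lies in \<open>E\<close>; they form a subspace of a library
  real vector space, so that \<^const>\<open>hull\<close> and \<^const>\<open>extreme_point_of\<close> apply.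
\<close>

definition vectors_on :: "'a set \<Rightarrow> ('a \<Rightarrow>\<^sub>0 real) set" where
  "vectors_on E = {x. Poly_Mapping.keys x \<subseteq> E}"

definition weight :: "('a \<Rightarrow>\<^sub>0 real) \<Rightarrow> 'a set \<Rightarrow> real" where
  "weight x F = (\<Sum>e\<in>F. Poly_Mapping.lookup x e)"

definition stable_matchings ::
    "'v set set \<Rightarrow> ('v \<Rightarrow> 'v set rel) \<Rightarrow> ('v set \<Rightarrow>\<^sub>0 real) set" where
  "stable_matchings E R =
     {x \<in> vectors_on E.
        (\<forall>e\<in>E. Poly_Mapping.lookup x e \<in> {0, 1}) \<and>
        (\<forall>e\<in>E. \<exists>i\<in>e. weight x {e' \<in> incident E i. (e', e) \<in> R i \<or> e' = e} = 1)}"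

definition stable_matching_polytope ::
    "'v set set \<Rightarrow> ('v \<Rightarrow> 'v set rel) \<Rightarrow> ('v set \<Rightarrow>\<^sub>0 real) set" where
  "stable_matching_polytope E R = convex hull (stable_matchings E R)"

definition dominating ::
    "'v set set \<Rightarrow> ('v \<Rightarrow> 'v set rel) \<Rightarrow> 'v set \<Rightarrow> 'v set set" where
  "dominating E R e = {e' \<in> E. \<exists>i\<in>e. (e', e) \<in> R i} \<union> {e}"

definition fractional_stable_matching_polytope ::
    "'v set \<Rightarrow> 'v set set \<Rightarrow> ('v \<Rightarrow> 'v set rel) \<Rightarrow> ('v set \<Rightarrow>\<^sub>0 real) set" where
  "fractional_stable_matching_polytope V E R =
     {x \<in> vectors_on E.
        (\<forall>i\<in>V. weight x (incident E i) \<le> 1) \<and>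
        (\<forall>e\<in>E. weight x (dominating E R e) \<ge> 1) \<and>
        (\<forall>e\<in>E. 0 \<le> Poly_Mapping.lookup x e \<and> Poly_Mapping.lookup x e \<le> 1)}"

definition integral_polytope :: "('a \<Rightarrow>\<^sub>0 real) set \<Rightarrow> bool" where
  "integral_polytope S \<longleftrightarrow>
     (\<forall>x. x extreme_point_of S \<longrightarrow> (\<forall>e. Poly_Mapping.lookup x e \<in> \<int>))"

end

theory Submission
  imports Defs
begin

text \<open>
  On four vertices take, besides the singletons, the intervals \<open>a = {1,2}\<close>, \<open>b = {1,2,3,4}\<close>,
  \<open>c = {2,3,4}\<close>, \<open>d = {3,4}\<close>, with preferences \<open>b > a\<close> at 1, \<open>a > c > b\<close> at 2,
  \<open>c > b > d\<close> at 3 and \<open>d > c > b\<close> at 4. The stability constraints of \<open>a\<close> and \<open>d\<close> together with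
  the degree constraints force \<open>x\<^sub>c = 0\<close> and \<open>x\<^sub>a = x\<^sub>d = 1 - x\<^sub>b\<close>, with weight 0 on singletons,
  and the stability constraint of \<open>c\<close> then becomes \<open>x\<^sub>b \<le> 1/2\<close>. Hence \<open>Q(I)\<close> is a segment, and
  its end \<open>x\<^sub>a = x\<^sub>b = x\<^sub>d = 1/2\<close> is a fractional extreme point. The extreme points of a convex
  hull belong to the generating set, so \<open>P(I)\<close> is always integral and differs from \<open>Q(I)\<close>.
\<close>

section \<open>Strict linear orders from ranking lists\<close>

fun list_order :: "'a list \<Rightarrow> 'a rel" where
  "list_order [] = {}"
| "list_order (x # xs) = {x} \<times> set xs \<union> list_order xs"

lemma list_order_subset: "list_order xs \<subseteq> set xs \<times> set xs"
  by (induction xs) auto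

lemma strict_linear_order_on_list_order:
  assumes "distinct xs"
  shows "strict_linear_order_on (set xs) (list_order xs)"
  using assms
proof (induction xs)
  case Nil
  then show ?case
    by (simp add: strict_linear_order_on_def)
next
  case (Cons x xs)
  then have tr: "trans (list_order xs)" and ir: "irrefl (list_order xs)"
    and tot: "total_on (set xs) (list_order xs)" and "x \<notin> set xs"
    by (auto simp: strict_linear_order_on_def)
  have sub: "a \<in> set xs \<and> b \<in> set xs" if "(a, b) \<in> list_order xs" for a b
    using that list_order_subset[of xs] by blast
  have "trans (list_order (x # xs))"
  proof (rule transI)
    fix a b c
    assume "(a, b) \<in> list_order (x # xs)" "(b, c) \<in> list_order (x # xs)"
    \<comment> \<open>Since b lies in \<open>set xs\<close>, it differs from x, so the second pair
      must come from the tail.\<close>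
    then have "(a = x \<and> b \<in> set xs \<or> (a, b) \<in> list_order xs) \<and> (b, c) \<in> list_order xs"
      using \<open>x \<notin> set xs\<close> sub[of a b] by auto
    then show "(a, c) \<in> list_order (x # xs)"
      using transD[OF tr, of a b c] sub[of b c] by auto
  qed
  moreover have "irrefl (list_order (x # xs))"
    using ir \<open>x \<notin> set xs\<close> by (auto simp: irrefl_def)
  moreover have "total_on (set (x # xs)) (list_order (x # xs))"
    using tot by (auto simp: total_on_def)
  ultimately show ?case
    by (simp add: strict_linear_order_on_def)
qed

lemma list_order_last:
  assumes "e \<in> set xs"
  shows "(e, y) \<in> list_order (xs @ [y])"
  using assms by (induction xs) auto

text \<open>Makes the edges preferred to a given one computable: they form the prefix of the ranking
  before it, which the simplifier can evaluate.\<close>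

lemma list_order_predecessors:
  assumes "distinct xs" and "y \<in> set xs"
  shows "{x. (x, y) \<in> list_order xs} = set (takeWhile (\<lambda>x. x \<noteq> y) xs)"
  using assms
proof (induction xs)
  case Nil
  then show ?case
    by simp
next
  case (Cons x xs)
  then show ?case
    using list_order_subset[of xs] by auto
qed

section \<open>Integrality of the hull of stable matchings\<close>

lemma integral_stable_matching_polytope: "integral_polytope (stable_matching_polytope E R)"
  unfolding integral_polytope_def
proof (intro allI impI)
  fix x :: "'a set \<Rightarrow>\<^sub>0 real" and e
  assume "x extreme_point_of stable_matching_polytope E R"
  then have "x \<in> stable_matchings E R"
    unfolding stable_matching_polytope_def by (rule extreme_point_of_convex_hull)
  then have "Poly_Mapping.keys x \<subseteq> E" and "e \<in> E \<Longrightarrow> Poly_Mapping.lookup x e \<in> {0, 1}"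
    by (auto simp: stable_matchings_def vectors_on_def)
  \<comment> \<open>Integrality is required at every index, so coordinates outside \<open>E\<close>
    are covered by the support condition.\<close>
  moreover from this have "Poly_Mapping.lookup x e = 0" if "e \<notin> E"
    using that by (auto simp flip: not_in_keys_iff_lookup_eq_zero)
  ultimately show "Poly_Mapping.lookup x e \<in> \<int>"
    by (cases "e \<in> E") auto
qed

section \<open>The example system\<close>

definition example_edges :: "nat set set" where
  "example_edges =
     {{1}, {2}, {3}, {4}, {1..2}, {1..4}, {2..4}, {3..4}}"

text \<open>Best edge first. The last branch is meant for vertex 4, and appending \<open>{i}\<close>
  makes the singleton least preferred at every vertex.\<close>

definition example_ranking :: "nat \<Rightarrow> nat set list" where
  "example_ranking i =
     (if i = 1 then [{1..4}, {1..2}]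
      else if i = 2 then [{1..2}, {2..4}, {1..4}]
      else if i = 3 then [{2..4}, {1..4}, {3..4}]
      else [{3..4}, {2..4}, {1..4}]) @ [{i}]"

abbreviation example_order :: "nat \<Rightarrow> nat set rel" where
  "example_order i \<equiv> list_order (example_ranking i)"

lemma singleton_eq_atLeastAtMost [simp]:
  fixes a b c :: "'a::order"
  shows "{c} = {a..b} \<longleftrightarrow> a = b \<and> b = c"
  by (metis atLeastAtMost_singleton_iff)

lemma vertices_eq: "{1..4} = {1, 2, 3, 4 :: nat}"
  by auto

lemma example_edges_members:
  "{1} \<in> example_edges" "{2} \<in> example_edges" "{3} \<in> example_edges" "{4} \<in> example_edges"
  "{1..2} \<in> example_edges" "{1..4} \<in> example_edges"
  "{2..4} \<in> example_edges" "{3..4} \<in> example_edges"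
  by (simp_all add: example_edges_def)

lemma incident_example:
  assumes "i \<in> {1..4}"
  shows "incident example_edges i = set (example_ranking i)"
proof -
  \<comment> \<open>As an intersection with an explicit finite set, the incident edges can be
    evaluated one edge at a time.\<close>
  have "incident example_edges i = example_edges \<inter> {e. i \<in> e}"
    by (auto simp: incident_def)
  moreover have "i = 1 \<or> i = 2 \<or> i = 3 \<or> i = 4"
    using assms unfolding vertices_eq by blast
  ultimately show ?thesis
    by (elim disjE) (simp_all add: example_edges_def example_ranking_def insert_commute)
qed

lemma distinct_example_ranking: "distinct (example_ranking i)"
  by (simp add: example_ranking_def)

lemma interval_hypergraph_example: "interval_hypergraph 4 example_edges"
proof -
  \<comment> \<open>Listing the endpoint pairs yields the interval form and the bounds 1 and 4
    together.\<close>
  have "example_edges = (\<lambda>(i, j). {i..j}) `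
      {(1, 1), (2, 2), (3, 3), (4, 4), (1, 2), (1, 4), (2, 4), (3, 4)}"
    by (simp add: example_edges_def)
  then have "\<exists>i j. 1 \<le> i \<and> i \<le> j \<and> j \<le> 4 \<and> e = {i..j}" if "e \<in> example_edges" for e
    using that unfolding \<open>example_edges = _\<close> by force
  then show ?thesis
    unfolding interval_hypergraph_def hypergraph_def
    by (metis atLeastatMost_subset_iff atLeastatMost_empty_iff finite_atLeastAtMost)
qed

lemma preference_system_example:
  "hypergraphic_preference_system {1..4} example_edges example_order"
  unfolding hypergraphic_preference_system_def
proof (intro conjI ballI impI)
  show "hypergraph {1..4} example_edges"
    using interval_hypergraph_example by (simp add: interval_hypergraph_def)
next
  fix i :: nat
  assume i: "i \<in> {1..4}"
  note inc = incident_example[OF i]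
  show "example_order i \<subseteq> incident example_edges i \<times> incident example_edges i"
    unfolding inc by (rule list_order_subset)
  show "strict_linear_order_on (incident example_edges i) (example_order i)"
    unfolding inc by (intro strict_linear_order_on_list_order distinct_example_ranking i)
  show "{i} \<in> example_edges"
    using i unfolding vertices_eq by (auto simp: example_edges_def)
  show "(e, {i}) \<in> example_order i" if "e \<in> incident example_edges i" "e \<noteq> {i}" for e
    using that unfolding inc example_ranking_def by (intro list_order_last) simp
qed

section \<open>Degree and stability constraints in coordinates\<close>

lemma weight_set: "distinct es \<Longrightarrow> weight x (set es) = (\<Sum>e\<leftarrow>es. Poly_Mapping.lookup x e)"
  by (simp add: weight_def sum.distinct_set_conv_list)

lemma weight_incident_example:
  "weight x (incident example_edges 1) =
     Poly_Mapping.lookup x {1..4} + Poly_Mapping.lookup x {1..2} + Poly_Mapping.lookup x {1}"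
  "weight x (incident example_edges 2) =
     Poly_Mapping.lookup x {1..2} + Poly_Mapping.lookup x {2..4} + Poly_Mapping.lookup x {1..4} +
     Poly_Mapping.lookup x {2}"
  "weight x (incident example_edges 3) =
     Poly_Mapping.lookup x {2..4} + Poly_Mapping.lookup x {1..4} + Poly_Mapping.lookup x {3..4} +
     Poly_Mapping.lookup x {3}"
  "weight x (incident example_edges 4) =
     Poly_Mapping.lookup x {3..4} + Poly_Mapping.lookup x {2..4} + Poly_Mapping.lookup x {1..4} +
     Poly_Mapping.lookup x {4}"
  by (simp_all add: incident_example weight_set distinct_example_ranking)
    (simp_all add: example_ranking_def)

text \<open>At each vertex of \<open>e\<close>, the edges preferred to \<open>e\<close> are those
  that precede it in the ranking there.\<close>

lemma dominating_example_eq: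
  assumes "e \<in> example_edges"
  shows "dominating example_edges example_order e =
    (\<Union>i\<in>e. set (takeWhile (\<lambda>f. f \<noteq> e) (example_ranking i))) \<union> {e}"
proof -
  have "{f \<in> example_edges. (f, e) \<in> example_order i} =
      set (takeWhile (\<lambda>f. f \<noteq> e) (example_ranking i))" if "i \<in> e" for i
  proof -
    have "i \<in> {1..4}"
      using assms interval_hypergraph_example that
      unfolding interval_hypergraph_def hypergraph_def by blast
    moreover from this have "e \<in> set (example_ranking i)"
      using assms that by (simp flip: incident_example add: incident_def)
    moreover have "example_order i \<subseteq> example_edges \<times> UNIV"
      using incident_example[OF calculation(1)] list_order_subset[of "example_ranking i"]
      by (auto simp: incident_def)
    ultimately show ?thesis
      by (subst list_order_predecessors[symmetric]) (auto simp: distinct_example_ranking)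
  qed
  then show ?thesis
    unfolding dominating_def by blast
qed

text \<open>The singleton closes its ranking, so all other edges at \<open>i\<close> precede it. Its
  stability constraint is thus the reverse of the degree constraint at \<open>i\<close>.\<close>

lemma dominating_singleton_example:
  assumes "i \<in> {1..4}"
  shows "dominating example_edges example_order {i} = incident example_edges i"
proof -
  have "{i} \<in> example_edges"
    using assms example_edges_members unfolding vertices_eq by blast
  moreover have "set (takeWhile (\<lambda>f. f \<noteq> {i}) (example_ranking i)) \<union> {{i}} =
      set (example_ranking i)"
    using assms unfolding vertices_eq by (auto simp: example_ranking_def)
  ultimately show ?thesis
    using assms by (simp add: dominating_example_eq incident_example)
qed

lemma dominating_example:
  "dominating example_edges example_order {1..2} = set [{1..2}, {1..4}]"
  "dominating example_edges example_order {1..4} = set [{1..2}, {1..4}, {2..4}, {3..4}]"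
  "dominating example_edges example_order {2..4} = set [{1..2}, {2..4}, {3..4}]"
  "dominating example_edges example_order {3..4} = set [{1..4}, {2..4}, {3..4}]"
proof -
  have "{1..2} = {1, 2 :: nat}" "{2..4} = {2, 3, 4 :: nat}" "{3..4} = {3, 4 :: nat}"
    by auto
  note members = this vertices_eq
  \<comment> \<open>Only the index set is expanded into vertices; the edges stay written as
    intervals, as in the rankings.\<close>
  have Union: "(\<Union>i\<in>{1..2 :: nat}. F i) = F 1 \<union> F 2"
    "(\<Union>i\<in>{1..4 :: nat}. F i) = F 1 \<union> F 2 \<union> F 3 \<union> F 4"
    "(\<Union>i\<in>{2..4 :: nat}. F i) = F 2 \<union> F 3 \<union> F 4"
    "(\<Union>i\<in>{3..4 :: nat}. F i) = F 3 \<union> F 4" for F :: "nat \<Rightarrow> nat set set"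
    unfolding members by (simp_all add: Un_assoc)
  show "dominating example_edges example_order {1..2} = set [{1..2}, {1..4}]"
    unfolding dominating_example_eq[OF example_edges_members(5)] Union
    by (simp add: example_ranking_def insert_commute)
  show "dominating example_edges example_order {1..4} = set [{1..2}, {1..4}, {2..4}, {3..4}]"
    unfolding dominating_example_eq[OF example_edges_members(6)] Union
    by (simp add: example_ranking_def insert_commute)
  show "dominating example_edges example_order {2..4} = set [{1..2}, {2..4}, {3..4}]"
    unfolding dominating_example_eq[OF example_edges_members(7)] Union
    by (simp add: example_ranking_def insert_commute)
  show "dominating example_edges example_order {3..4} = set [{1..4}, {2..4}, {3..4}]"
    unfolding dominating_example_eq[OF example_edges_members(8)] Union
    by (simp add: example_ranking_def insert_commute)
qed

lemma weight_dominating_example: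
  "weight x (dominating example_edges example_order {1..2}) =
     Poly_Mapping.lookup x {1..2} + Poly_Mapping.lookup x {1..4}"
  "weight x (dominating example_edges example_order {1..4}) =
     Poly_Mapping.lookup x {1..2} + Poly_Mapping.lookup x {1..4} +
     Poly_Mapping.lookup x {2..4} + Poly_Mapping.lookup x {3..4}"
  "weight x (dominating example_edges example_order {2..4}) =
     Poly_Mapping.lookup x {1..2} + Poly_Mapping.lookup x {2..4} + Poly_Mapping.lookup x {3..4}"
  "weight x (dominating example_edges example_order {3..4}) =
     Poly_Mapping.lookup x {1..4} + Poly_Mapping.lookup x {2..4} + Poly_Mapping.lookup x {3..4}"
  unfolding dominating_example by (subst weight_set; simp)+

section \<open>The polytope lies in a segment\<close>

abbreviation example_polytope :: "(nat set \<Rightarrow>\<^sub>0 real) set" where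
  "example_polytope \<equiv>
     fractional_stable_matching_polytope {1..4} example_edges example_order"

text \<open>A point is determined by its coordinate at \<open>{1..4}\<close>, so extremality can be
  tested on that coordinate alone.\<close>

lemma example_polytope_segment:
  assumes "x \<in> example_polytope"
  shows "Poly_Mapping.lookup x {1..4} \<le> 1 / 2"
    and "Poly_Mapping.lookup x e =
      (if e = {1..2} \<or> e = {3..4} then 1 - Poly_Mapping.lookup x {1..4}
       else if e = {1..4} then Poly_Mapping.lookup x {1..4} else 0)"
proof -
  have vec: "Poly_Mapping.keys x \<subseteq> example_edges"
    and deg: "\<And>i. i \<in> {1, 2, 3, 4} \<Longrightarrow> weight x (incident example_edges i) \<le> 1"
    and dom: "\<And>e. e \<in> example_edges \<Longrightarrow>
      weight x (dominating example_edges example_order e) \<ge> 1"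
    and pos: "\<And>e. e \<in> example_edges \<Longrightarrow> 0 \<le> Poly_Mapping.lookup x e"
    using assms unfolding fractional_stable_matching_polytope_def vectors_on_def vertices_eq
    by auto
  have "weight x (incident example_edges 1) \<le> 1" "weight x (incident example_edges 2) \<le> 1"
    "weight x (incident example_edges 3) \<le> 1" "weight x (incident example_edges 4) \<le> 1"
    by (simp_all add: deg)
  \<comment> \<open>The members 5, 7 and 8 are \<open>{1..2}\<close>, \<open>{2..4}\<close> and
    \<open>{3..4}\<close>. Against the degree bounds, the first and last become equalities; the
    middle one then reads 2 (1 - b) \<ge> 1, with b the coordinate at \<open>{1..4}\<close>.\<close>
  note constraints = this[unfolded weight_incident_example]
    example_edges_members(5,7,8)[THEN dom, unfolded weight_dominating_example]
    example_edges_members[THEN pos]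
  show "Poly_Mapping.lookup x {1..4} \<le> 1 / 2"
    using constraints by linarith
  have vals: "Poly_Mapping.lookup x {1} = 0" "Poly_Mapping.lookup x {2} = 0"
    "Poly_Mapping.lookup x {3} = 0" "Poly_Mapping.lookup x {4} = 0"
    "Poly_Mapping.lookup x {2..4} = 0"
    "Poly_Mapping.lookup x {1..2} = 1 - Poly_Mapping.lookup x {1..4}"
    "Poly_Mapping.lookup x {3..4} = 1 - Poly_Mapping.lookup x {1..4}"
    using constraints by linarith+
  show "Poly_Mapping.lookup x e =
      (if e = {1..2} \<or> e = {3..4} then 1 - Poly_Mapping.lookup x {1..4}
       else if e = {1..4} then Poly_Mapping.lookup x {1..4} else 0)"
  proof (cases "e \<in> example_edges")
    case True
    then show ?thesis
      using vals by (auto simp: example_edges_def)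
  next
    case False
    then have "Poly_Mapping.lookup x e = 0"
      using vec by (auto simp: in_keys_iff)
    then show ?thesis
      using False by (auto simp: example_edges_def)
  qed
qed

section \<open>The fractional extreme point\<close>

lemma lookup_scaleR:
  fixes x :: "'a \<Rightarrow>\<^sub>0 'b::real_vector"
  shows "Poly_Mapping.lookup (r *\<^sub>R x) e = r *\<^sub>R Poly_Mapping.lookup x e"
proof -
  \<comment> \<open>Scaling is defined through \<open>Abs_poly_mapping\<close>, which can be
    evaluated pointwise once the support is known to be finite.\<close>
  have "finite {i. r *\<^sub>R Poly_Mapping.lookup x i \<noteq> 0}"
    by (rule finite_subset[OF _ finite_lookup[of x]]) auto
  then show ?thesis
    by (simp add: scaleR_poly_mapping_def lookup_Abs_poly_mapping)
qed

definition half_point :: "nat set \<Rightarrow>\<^sub>0 real" where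
  "half_point = Poly_Mapping.single {1..2} (1 / 2) + Poly_Mapping.single {1..4} (1 / 2)
     + Poly_Mapping.single {3..4} (1 / 2)"

lemma lookup_half_point:
  "Poly_Mapping.lookup half_point e =
     (if e = {1..2} \<or> e = {1..4} \<or> e = {3..4} then 1 / 2 else 0)"
  by (auto simp: half_point_def lookup_add lookup_single when_def)

lemma half_point_in_example_polytope: "half_point \<in> example_polytope"
proof -
  have "half_point \<in> vectors_on example_edges"
    using example_edges_members
    by (auto simp: vectors_on_def in_keys_iff lookup_half_point split: if_splits)
  \<comment> \<open>Every vertex lies in exactly two of the three edges of weight 1/2. Equality
    serves both the degree bounds and the stability of singletons.\<close>
  moreover have deg: "weight half_point (incident example_edges i) = 1" if "i \<in> {1..4}" for i
    using that unfolding vertices_eq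
    by (auto simp: weight_incident_example[simplified] lookup_half_point)
  moreover have "weight half_point (dominating example_edges example_order e) \<ge> 1"
    if "e \<in> example_edges" for e
  proof -
    have "(\<exists>i\<in>{1..4}. e = {i}) \<or> e \<in> {{1..2}, {1..4}, {2..4}, {3..4}}"
      using that unfolding example_edges_def by (elim insertE emptyE) simp_all
    then consider i where "i \<in> {1..4}" "e = {i}"
      | "e \<in> {{1..2}, {1..4}, {2..4}, {3..4}}"
      by metis
    then show ?thesis
    proof cases
      case 1
      then show ?thesis
        by (simp add: dominating_singleton_example deg)
    next
      case 2
      then show ?thesis
        by (elim insertE emptyE)
            (simp_all add: weight_dominating_example[simplified] lookup_half_point)
    qed
  qed
  ultimately show ?thesis
    by (simp add: fractional_stable_matching_polytope_def lookup_half_point)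
qed

lemma half_point_unique:
  assumes "x \<in> example_polytope" and "Poly_Mapping.lookup x {1..4} = 1 / 2"
  shows "x = half_point"
  using example_polytope_segment(2)[OF assms(1), unfolded assms(2)]
  by (intro poly_mapping_eqI) (simp add: lookup_half_point)

text \<open>The coordinate at \<open>{1..4}\<close> attains its maximum 1/2 over the polytope only
  at \<open>half_point\<close>.\<close>

lemma half_point_extreme: "half_point extreme_point_of example_polytope"
  unfolding extreme_point_of_def
proof (intro conjI ballI notI)
  fix y z
  assume y: "y \<in> example_polytope" and z: "z \<in> example_polytope"
    and "half_point \<in> open_segment y z"
  then obtain u where neq: "y \<noteq> z" and u: "0 < u" "u < 1"
    and eq: "half_point = (1 - u) *\<^sub>R y + u *\<^sub>R z"
    by (auto simp: in_segment)
  let ?y = "Poly_Mapping.lookup y {1..4}" and ?z = "Poly_Mapping.lookup z {1..4}"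
  have "1 / 2 = (1 - u) * ?y + u * ?z"
    using arg_cong[OF eq, of "\<lambda>x. Poly_Mapping.lookup x {1..4}"]
    by (simp add: lookup_half_point lookup_add lookup_scaleR)
  \<comment> \<open>A positive combination of the two nonnegative slacks vanishes, so both slacks
    are zero.\<close>
  then have "(1 - u) * (1 / 2 - ?y) + u * (1 / 2 - ?z) = 0"
    by (simp add: field_simps)
  moreover have "?y \<le> 1 / 2" "?z \<le> 1 / 2"
    using example_polytope_segment(1) y z by blast+
  ultimately have "?y = 1 / 2" "?z = 1 / 2"
    using u by (simp_all add: add_nonneg_eq_0_iff)
  then show False
    using half_point_unique y z neq by metis
qed (rule half_point_in_example_polytope)

theorem theorem4p1:
  shows "\<exists>(n :: nat) (E :: nat set set) (R :: nat \<Rightarrow> nat set rel).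
           hypergraphic_preference_system {1..n} E R \<and>
           interval_hypergraph n E \<and>
           \<not> integral_polytope (fractional_stable_matching_polytope {1..n} E R) \<and>
           stable_matching_polytope E R \<noteq> fractional_stable_matching_polytope {1..n} E R"
proof -
  have "Poly_Mapping.lookup half_point {1..2} \<notin> \<int>"
    by (simp add: lookup_half_point)
  then have "\<not> integral_polytope example_polytope"
    using half_point_extreme unfolding integral_polytope_def by blast
  moreover from this have "stable_matching_polytope example_edges example_order \<noteq> example_polytope"
    using integral_stable_matching_polytope by metis
  ultimately show ?thesis
    using preference_system_example interval_hypergraph_example by blast
qed

end
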